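(* Let $\mathrm{a}_{n,k}^{\mathrm{vl}}(123,132)$ denote the number of permutations of $\{1,\dots,n\}$ that avoid both $123$ and $132$ and have exactly $k$ valleys. Then $$\mathrm{a}_{n,k}^{\mathrm{vl}}(123,132)=2\binom{n-1}{2k}.$$
   Context: $\mathcal{S}_n$ is the set of permutations $\pi=\pi_1\cdots\pi_n$ of $\{1,\dots,n\}$. For $\rho\in\mathcal{S}_m$, $\pi\in\mathcal{S}_n$ contains $\rho$ if there are indices $1\le i_1<\cdots<i_m\le n$ such that $\pi_{i_a}<\pi_{i_b}$ if and only if $\rho_a<\rho_b$; otherwise $\pi$ avoids $\rho$. The number of valleys is $\mathrm{vl}(\pi)=|\{i:\pi_i>\pi_{i+1}\text{ and }\pi_{i+1}<\pi_{i+2}\}|$, where $1\le i\le n-2$.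
   Formalization: The formula is proved for n ≥ 2; the statement gives no range for n, but it fails for n = 1, k = 0 (one permutation, while 2·C(0,0) = 2) and likewise for n = 0, k = 0. *)

theory Defs
  imports "HOL-Combinatorics.Multiset_Permutations"
begin

text \<open>
  A permutation in \<open>S\<^sub>n\<close> is given by its one-line notation, a list in
  \<open>permutations_of_set {1..n}\<close>. List positions are counted from 0, so the entry
  \<open>\<pi>\<^sub>i\<close> of the usual notation is \<open>\<pi> ! (i - 1)\<close>.
\<close>

definition contains_pattern :: "nat list \<Rightarrow> nat list \<Rightarrow> bool" where
  "contains_pattern \<pi> \<rho> \<longleftrightarrow>
     (\<exists>f :: nat \<Rightarrow> nat.
        strict_mono_on {..<length \<rho>} f \<and>
        f ` {..<length \<rho>} \<subseteq> {..<length \<pi>} \<and>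
        (\<forall>a < length \<rho>. \<forall>b < length \<rho>. \<pi> ! f a < \<pi> ! f b \<longleftrightarrow> \<rho> ! a < \<rho> ! b))"

abbreviation avoids_pattern :: "nat list \<Rightarrow> nat list \<Rightarrow> bool" where
  "avoids_pattern \<pi> \<rho> \<equiv> \<not> contains_pattern \<pi> \<rho>"

definition vl :: "nat list \<Rightarrow> nat" where
  "vl \<pi> = card {i. i + 2 < length \<pi> \<and> \<pi> ! i > \<pi> ! (i + 1) \<and> \<pi> ! (i + 1) < \<pi> ! (i + 2)}"

definition a_vl :: "nat \<Rightarrow> nat \<Rightarrow> nat list set \<Rightarrow> nat" where
  "a_vl n k P =
     card {\<pi> \<in> permutations_of_set {1..n}. (\<forall>\<rho> \<in> P. avoids_pattern \<pi> \<rho>) \<and> vl \<pi> = k}"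

end

theory Submission
  imports Defs
begin

text \<open>
  A permutation avoids 123 and 132 iff every entry has at most one larger entry to its right,
  i.e. iff every entry is the largest or second largest of the entries from its position on.
  In such a permutation \<open>x # ys\<close> every ascent of \<open>ys\<close> is the right half of a valley, because two
  consecutive ascents would form a 123; so the valleys of \<open>x # ys\<close> correspond to the ascents of
  \<open>ys\<close>. There are two choices for \<open>x\<close>, and splitting by whether the first entry is the largest
  gives a Pascal-type recurrence for the number of such \<open>ys\<close> of length \<open>m\<close> with \<open>k\<close> ascents,
  solved by \<open>m choose 2k\<close>.
\<close>

section \<open>Avoidance of 123 and 132 as a condition on later entries\<close>

primrec one_larger :: "'a :: linorder list \<Rightarrow> bool" where
  "one_larger [] \<longleftrightarrow> True"
| "one_larger (x # ys) \<longleftrightarrow>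
     (\<forall>y\<in>set ys. \<forall>z\<in>set ys. x < y \<longrightarrow> x < z \<longrightarrow> y = z) \<and> one_larger ys"

fun ascents :: "'a :: linorder list \<Rightarrow> nat" where
  "ascents (x # y # zs) = of_bool (x < y) + ascents (y # zs)"
| "ascents _ = 0"

lemma ascents_Cons:
  "ascents (x # ys) = of_bool (ys \<noteq> [] \<and> x < hd ys) + ascents ys"
  by (cases ys) auto

text \<open>An embedding of three positions is determined by its three values. Pairing each position
  with its pattern letter lets the nine order conditions be enumerated by ranging over a
  three-element set.\<close>

lemma contains_pattern_length_3:
  "contains_pattern xs [p, q, r] \<longleftrightarrow>
     (\<exists>i j l. i < j \<and> j < l \<and> l < length xs \<and>
        (\<forall>(a, c)\<in>{(i, p), (j, q), (l, r)}. \<forall>(b, d)\<in>{(i, p), (j, q), (l, r)}.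
           xs ! a < xs ! b \<longleftrightarrow> c < d))"
    (is "?L \<longleftrightarrow> ?R")
proof
  have lt3: "{..<length [p, q, r]} = {0, 1, 2}"
    by auto
  have all3: "(\<forall>a < length [p, q, r]. P a) \<longleftrightarrow> P 0 \<and> P 1 \<and> P 2" for P
    by (auto simp: less_Suc_eq numeral_2_eq_2)
  {
    assume ?L
    then obtain f where f: "strict_mono_on {0, 1, 2 :: nat} f" "f ` {0, 1, 2} \<subseteq> {..<length xs}"
      "\<forall>a < length [p, q, r]. \<forall>b < length [p, q, r].
         xs ! f a < xs ! f b \<longleftrightarrow> [p, q, r] ! a < [p, q, r] ! b"
      unfolding contains_pattern_def lt3 by blast
    show ?R
      using f unfolding all3
      by (intro exI[of _ "f 0"] exI[of _ "f 1"] exI[of _ "f 2"]) (simp add: strict_mono_on_def)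
  next
    assume ?R
    then obtain i j l where ijl: "i < j" "j < l" "l < length xs"
      "\<forall>(a, c)\<in>{(i, p), (j, q), (l, r)}. \<forall>(b, d)\<in>{(i, p), (j, q), (l, r)}.
         xs ! a < xs ! b \<longleftrightarrow> c < d"
      by blast
    \<comment> \<open>List lookup serves as the embedding; its unspecified values beyond index 2 do
      not matter, as monotonicity is demanded on {0, 1, 2} only.\<close>
    show ?L
      unfolding contains_pattern_def lt3 all3 using ijl
      by (intro exI[of _ "\<lambda>a. [i, j, l] ! a"]) (auto simp: strict_mono_on_def)
  }
qed

text \<open>Passes from values to positions: by distinctness, two larger values coincide exactly if
  their positions do.\<close>

lemma one_larger_iff_nth:
  assumes "distinct xs"
  shows "one_larger xs \<longleftrightarrow>
     (\<forall>i j l. i < j \<longrightarrow> j < l \<longrightarrow> l < length xs \<longrightarrow> \<not> (xs ! i < xs ! j \<and> xs ! i < xs ! l))"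
  using assms
proof (induction xs)
  case (Cons x ys)
  have "(\<forall>y\<in>set ys. \<forall>z\<in>set ys. x < y \<longrightarrow> x < z \<longrightarrow> y = z) \<longleftrightarrow>
      (\<forall>j l. j < l \<longrightarrow> l < length ys \<longrightarrow> \<not> (x < ys ! j \<and> x < ys ! l))" (is "?A \<longleftrightarrow> ?B")
  proof
    assume ?A
    then show ?B
      using Cons.prems
      by (metis distinct.simps(2) less_irrefl less_trans nth_eq_iff_index_eq nth_mem)
  next
    assume ?B
    then show ?A
      by (metis in_set_conv_nth linorder_neqE_nat)
  qed
  moreover have "(\<forall>i j l. i < j \<longrightarrow> j < l \<longrightarrow> l < length (x # ys) \<longrightarrow>
        \<not> ((x # ys) ! i < (x # ys) ! j \<and> (x # ys) ! i < (x # ys) ! l)) \<longleftrightarrow>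
      ?B \<and> (\<forall>i j l. i < j \<longrightarrow> j < l \<longrightarrow> l < length ys \<longrightarrow> \<not> (ys ! i < ys ! j \<and> ys ! i < ys ! l))"
    (is "?C \<longleftrightarrow> ?B \<and> ?D")
  proof (intro iffI conjI)
    assume C: ?C
    show ?B
      using C[rule_format, of 0 "Suc j" "Suc l" for j l] by auto
    show ?D
      using C[rule_format, of "Suc i" "Suc j" "Suc l" for i j l] by auto
  next
    assume BD: "?B \<and> ?D"
    show ?C
    proof (intro allI impI)
      fix i j l :: nat
      assume ijl: "i < j" "j < l" "l < length (x # ys)"
      \<comment> \<open>Both \<open>j\<close> and \<open>l\<close> exceed \<open>i\<close>, so they
        point into \<open>ys\<close>; only \<open>i\<close> can be the position of
        \<open>x\<close>.\<close>
      then obtain j' l' where "j = Suc j'" "l = Suc l'"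
        by (metis less_nat_zero_code not0_implies_Suc)
      then show "\<not> ((x # ys) ! i < (x # ys) ! j \<and> (x # ys) ! i < (x # ys) ! l)"
        using BD ijl by (cases i) auto
    qed
  qed
  ultimately show ?case
    using Cons by auto
qed simp

text \<open>Two larger entries to the right of an entry complete a 123 if they increase and a 132 if
  they decrease; distinctness leaves no third case.\<close>

lemma avoids_123_132_iff:
  assumes "distinct xs"
  shows "avoids_pattern xs [1, 2, 3] \<and> avoids_pattern xs [1, 3, 2] \<longleftrightarrow> one_larger xs"
proof -
  have "contains_pattern xs [1, 2, 3] \<or> contains_pattern xs [1, 3, 2] \<longleftrightarrow>
      (\<exists>i j l. i < j \<and> j < l \<and> l < length xs \<and> xs ! i < xs ! j \<and> xs ! i < xs ! l)"
    (is "?L \<longleftrightarrow> ?R")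
  proof
    assume ?L
    then show ?R
      by (auto simp: contains_pattern_length_3)
  next
    assume ?R
    then obtain i j l where ijl: "i < j" "j < l" "l < length xs" "xs ! i < xs ! j" "xs ! i < xs ! l"
      by blast
    then have "xs ! j \<noteq> xs ! l"
      using assms by (simp add: nth_eq_iff_index_eq)
    then consider "xs ! j < xs ! l" | "xs ! l < xs ! j"
      by linarith
    then show ?L
    proof cases
      case 1
      then have "contains_pattern xs [1, 2, 3]"
        unfolding contains_pattern_length_3 using ijl
        by (intro exI[of _ i] exI[of _ j] exI[of _ l]) auto
      then show ?thesis ..
    next
      case 2
      then have "contains_pattern xs [1, 3, 2]"
        unfolding contains_pattern_length_3 using ijl
        by (intro exI[of _ i] exI[of _ j] exI[of _ l]) auto
      then show ?thesis ..
    qed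
  qed
  then show ?thesis
    using one_larger_iff_nth[OF assms] by blast
qed

section \<open>Valleys as ascents of the tail\<close>

lemma vl_Cons_Cons_Cons:
  "vl (x # y # z # zs) = of_bool (x > y \<and> y < z) + vl (y # z # zs)"
proof -
  let ?V = "\<lambda>xs :: nat list. {i. i + 2 < length xs \<and> xs ! i > xs ! (i + 1) \<and> xs ! (i + 1) < xs ! (i + 2)}"
  have "finite (?V (y # z # zs))"
    by (rule finite_subset[of _ "{..length (y # z # zs)}"]) auto
  moreover have "?V (x # y # z # zs) =
      (if x > y \<and> y < z then {0} else {}) \<union> Suc ` ?V (y # z # zs)"
  proof (rule set_eqI)
    fix i
    show "i \<in> ?V (x # y # z # zs) \<longleftrightarrow>
        i \<in> (if x > y \<and> y < z then {0} else {}) \<union> Suc ` ?V (y # z # zs)"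
      by (cases i) auto
  qed
  ultimately show ?thesis
    by (auto simp: vl_def card_image)
qed

lemma vl_Cons_eq_ascents:
  "one_larger (x # ys) \<Longrightarrow> distinct (x # ys) \<Longrightarrow> vl (x # ys) = ascents ys"
proof (induction ys arbitrary: x)
  case (Cons y ys)
  show ?case
  proof (cases ys)
    case Nil
    then show ?thesis
      by (simp add: vl_def)
  next
    case (Cons z zs)
    \<comment> \<open>If \<open>x < y < z\<close>, then \<open>x\<close> would have two larger
      entries after it. So an ascent at the front of the tail is preceded by a descent.\<close>
    have "y < z \<longrightarrow> y < x"
      using Cons.prems by (force simp: Cons)
    then show ?thesis
      using Cons.IH[of y] Cons.prems by (auto simp: Cons vl_Cons_Cons_Cons)
  qed
qed (simp add: vl_def)

section \<open>Recursion on the two largest elements and the count by ascents\<close>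

definition one_larger_perms :: "'a :: linorder set \<Rightarrow> 'a list set" where
  "one_larger_perms A = {xs \<in> permutations_of_set A. one_larger xs}"

lemma finite_one_larger_perms [simp]: "finite (one_larger_perms A)"
  by (simp add: one_larger_perms_def)

lemma one_larger_perms_nonempty:
  "A \<noteq> {} \<Longrightarrow> xs \<in> one_larger_perms A \<Longrightarrow> xs \<noteq> [] \<and> hd xs \<in> A"
  by (cases xs) (auto simp: one_larger_perms_def permutations_of_set_def)

text \<open>A first entry from \<open>A\<close> would be followed by the two larger entries
  \<open>u\<close> and \<open>v\<close>. Conversely, \<open>u\<close> or \<open>v\<close> in front
  has at most one larger entry after it and so puts no constraint on the rest.\<close>

lemma one_larger_perms_insert2:
  assumes "u \<notin> A" "v \<notin> A" "v < u" "\<forall>x\<in>A. x < v"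
  shows "one_larger_perms (insert u (insert v A)) =
    (#) u ` one_larger_perms (insert v A) \<union> (#) v ` one_larger_perms (insert u A)"
proof (intro equalityI subsetI)
  fix xs
  assume xs: "xs \<in> one_larger_perms (insert u (insert v A))"
  then obtain x ys where "xs = x # ys"
    using one_larger_perms_nonempty by (metis insert_not_empty neq_Nil_conv)
  then have *: "one_larger ys" "distinct ys" "x \<notin> set ys" "insert x (set ys) = insert u (insert v A)"
    "\<forall>y\<in>set ys. \<forall>z\<in>set ys. x < y \<longrightarrow> x < z \<longrightarrow> y = z"
    using xs by (auto simp: one_larger_perms_def permutations_of_set_def)
  have "x = u \<or> x = v"
  proof (rule ccontr)
    assume "\<not> (x = u \<or> x = v)"
    then have "x \<in> A" "u \<in> set ys" "v \<in> set ys"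
      using * by auto
    then show False
      using * assms by (metis order.strict_trans order_less_irrefl)
  qed
  moreover have "set ys = insert u (insert v A) - {x}"
    using * by auto
  moreover have "insert u (insert v A) - {u} = insert v A" "insert u (insert v A) - {v} = insert u A"
    using assms by auto
  ultimately have "x = u \<and> ys \<in> one_larger_perms (insert v A) \<or>
      x = v \<and> ys \<in> one_larger_perms (insert u A)"
    using *(1,2) unfolding one_larger_perms_def permutations_of_set_def by force
  then show "xs \<in> (#) u ` one_larger_perms (insert v A) \<union> (#) v ` one_larger_perms (insert u A)"
    using \<open>xs = x # ys\<close> by blast
next
  fix xs
  assume "xs \<in> (#) u ` one_larger_perms (insert v A) \<union> (#) v ` one_larger_perms (insert u A)"
  moreover have "\<not> v < x" "\<not> u < x" if "x \<in> A" for x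
    using assms(3,4) that by fastforce+
  moreover have "\<not> u < v"
    using assms(3) by simp
  ultimately show "xs \<in> one_larger_perms (insert u (insert v A))"
    using assms by (auto simp: one_larger_perms_def permutations_of_set_def)
qed

text \<open>Brings a finite set with at least two elements into the form needed for the recursion on
  the first entry.\<close>

lemma split_off_two_largest:
  fixes S :: "'a :: linorder set"
  assumes "finite S" "card S = Suc (Suc m)"
  obtains u v A where "S = insert u (insert v A)" "u \<notin> A" "v \<notin> A" "v < u" "\<forall>x\<in>A. x < v"
    "finite A" "card A = m"
proof -
  define u where "u = Max S"
  define v where "v = Max (S - {u})"
  have u: "u \<in> S"
    using assms unfolding u_def by (intro Max_in) auto
  then have card: "card (S - {u}) = Suc m"
    using assms by simp
  then have "S - {u} \<noteq> {}"
    by (metis card.empty nat.distinct(1))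
  then have v: "v \<in> S - {u}"
    unfolding v_def using assms by (intro Max_in) auto
  show ?thesis
  proof
    show "S = insert u (insert v (S - {u} - {v}))"
      using u v by auto
    show "v < u"
      using v assms by (auto simp: u_def less_le)
    show "\<forall>x\<in>S - {u} - {v}. x < v"
      using assms by (auto simp: v_def less_le)
    show "card (S - {u} - {v}) = m"
      using v card assms by simp
  qed (use assms in auto)
qed

text \<open>The two counts are proved together because the second largest element in front creates
  an ascent exactly when the rest starts with its maximum. The ground set is arbitrary since
  deleting the first entry need not leave an interval.\<close>

lemma card_one_larger_perms_ascents:
  fixes S :: "'a :: linorder set"
  assumes "finite S" "card S = Suc m"
  shows "card {xs \<in> one_larger_perms S. ascents xs = k} = Suc m choose (2 * k)"
    and "card {xs \<in> one_larger_perms S. ascents xs = k \<and> hd xs = Max S} = m choose (2 * k)"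
  using assms
proof (induction m arbitrary: S k)
  case 0
  {
    case 1
    \<comment> \<open>The only arrangement is \<open>[x]\<close>, without ascents, and
      \<open>1 choose (2 * k)\<close> is 1 for \<open>k = 0\<close> and 0 otherwise.\<close>
    then obtain x where "S = {x}"
      by (metis One_nat_def card_1_singletonE)
    then have "{xs \<in> one_larger_perms S. ascents xs = k} = (if k = 0 then {[x]} else {})"
      by (auto simp: one_larger_perms_def)
    then show ?case
      by simp
  next
    case 2
    then obtain x where "S = {x}"
      by (metis One_nat_def card_1_singletonE)
    then have "{xs \<in> one_larger_perms S. ascents xs = k \<and> hd xs = Max S} = (if k = 0 then {[x]} else {})"
      by (auto simp: one_larger_perms_def)
    then show ?case
      by simp
  }
next
  case (Suc m)
  have IH1: "card {xs \<in> one_larger_perms T. ascents xs = j} = Suc m choose (2 * j)"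
    if "finite T" "card T = Suc m" for T :: "'a set" and j
    using Suc.IH(1) that by blast
  have IH2: "card {xs \<in> one_larger_perms T. ascents xs = j \<and> hd xs = Max T} = m choose (2 * j)"
    if "finite T" "card T = Suc m" for T :: "'a set" and j
    using Suc.IH(2) that by blast
  have both: "card {xs \<in> one_larger_perms S. ascents xs = k} = Suc (Suc m) choose (2 * k) \<and>
      card {xs \<in> one_larger_perms S. ascents xs = k \<and> hd xs = Max S} = Suc m choose (2 * k)"
    if S: "finite S" "card S = Suc (Suc m)" for S :: "'a set" and k
  proof -
    obtain u v A where A: "S = insert u (insert v A)" "u \<notin> A" "v \<notin> A" "v < u" "\<forall>x\<in>A. x < v"
        "finite A" "card A = m"
      using split_off_two_largest[OF S] .
    let ?U = "one_larger_perms (insert u A)" and ?V = "one_larger_perms (insert v A)"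
    \<comment> \<open>These are the tails that may follow \<open>v\<close>: in \<open>?G\<close> the
      step from \<open>v\<close> to \<open>u\<close> adds an ascent, in \<open>?H\<close> it does
      not. Writing \<open>Suc (ascents ys) = k\<close> makes \<open>?G\<close> empty for
      \<open>k = 0\<close> and avoids truncated subtraction.\<close>
    let ?G = "{ys \<in> ?U. Suc (ascents ys) = k \<and> hd ys = u}"
    let ?H = "{ys \<in> ?U. ascents ys = k \<and> hd ys \<noteq> u}"
    have Max_S: "Max S = u"
      using A by (intro Max_eqI) (auto intro: less_imp_le)
    have Max_U: "Max (insert u A) = u"
      using A by (intro Max_eqI) (auto intro: less_imp_le)
    have perms: "one_larger_perms S = (#) u ` ?V \<union> (#) v ` ?U"
      using A one_larger_perms_insert2 by metis
    have perms_Collect: "{xs \<in> one_larger_perms S. P xs} =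
        (#) u ` {ys \<in> ?V. P (u # ys)} \<union> (#) v ` {ys \<in> ?U. P (v # ys)}" for P
      unfolding perms by auto
    \<comment> \<open>Prepending the maximum \<open>u\<close> never creates an ascent; prepending
      \<open>v\<close> does so only in front of \<open>u\<close>, as all of \<open>A\<close> lies
      below \<open>v\<close>.\<close>
    have asc_u: "ascents (u # ys) = ascents ys" if "ys \<in> ?V" for ys
      using one_larger_perms_nonempty[OF _ that] A by (fastforce simp: ascents_Cons)
    have asc_v: "ascents (v # ys) = of_bool (hd ys = u) + ascents ys" if "ys \<in> ?U" for ys
      using one_larger_perms_nonempty[OF _ that] A by (fastforce simp: ascents_Cons)
    have top: "{xs \<in> one_larger_perms S. ascents xs = k \<and> hd xs = Max S} =
        (#) u ` {ys \<in> ?V. ascents ys = k}"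
      unfolding perms_Collect Max_S using A asc_u by auto
    then have card_top:
      "card {xs \<in> one_larger_perms S. ascents xs = k \<and> hd xs = Max S} = Suc m choose (2 * k)"
      using IH1[of "insert v A" k] A by (simp add: card_image)
    have "{xs \<in> one_larger_perms S. ascents xs = k} =
        {xs \<in> one_larger_perms S. ascents xs = k \<and> hd xs = Max S} \<union> (#) v ` (?G \<union> ?H)"
      unfolding perms_Collect Max_S using A asc_u asc_v by (auto split: if_splits)
    moreover have "{xs \<in> one_larger_perms S. ascents xs = k \<and> hd xs = Max S} \<inter> (#) v ` (?G \<union> ?H) = {}"
      unfolding Max_S using A by auto
    ultimately have "card {xs \<in> one_larger_perms S. ascents xs = k} =
        (Suc m choose (2 * k)) + card (?G \<union> ?H)"
      using card_top by (simp add: card_Un_disjoint card_image)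
    also have "card (?G \<union> ?H) = card ?G + card ?H"
      by (intro card_Un_disjoint) auto
    \<comment> \<open>Counted by complement: the first induction hypothesis counts all tails over
      \<open>insert u A\<close> with \<open>k\<close> ascents, the second those that start with the
      maximum \<open>u\<close>.\<close>
    also have "card ?H = (Suc m choose (2 * k)) - (m choose (2 * k))"
    proof -
      have "?H = {ys \<in> ?U. ascents ys = k} - {ys \<in> ?U. ascents ys = k \<and> hd ys = u}"
        by auto
      also have "card \<dots> = card {ys \<in> ?U. ascents ys = k} - card {ys \<in> ?U. ascents ys = k \<and> hd ys = u}"
        by (intro card_Diff_subset) auto
      finally show ?thesis
        using IH1[of "insert u A" k] IH2[of "insert u A" k] A Max_U by simp
    qed
    also have "(Suc m choose (2 * k)) + (card ?G + ((Suc m choose (2 * k)) - (m choose (2 * k)))) =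
        Suc (Suc m) choose (2 * k)"
    \<comment> \<open>For \<open>k = Suc j\<close>, Pascal's rule turns the difference into
      \<open>m choose (2 * j + 1)\<close>, and two more uses combine it with \<open>card ?G\<close>
      and the remaining summand. For \<open>k = 0\<close>, \<open>?G\<close> is empty and the
      difference is 0.\<close>
    proof (cases k)
      case (Suc j)
      then have "card ?G = m choose (2 * j)"
        using IH2[of "insert u A" j] A Max_U by simp
      then show ?thesis
        using Suc by simp
    qed simp
    finally show ?thesis
      using card_top by blast
  qed
  {
    case 1
    then show ?case
      using both by blast
  next
    case 2
    then show ?case
      using both by blast
  }
qed

section \<open>The count by valleys\<close>

theorem proposition18:
  fixes n k :: nat
  assumes "n \<ge> 2"
  shows "a_vl n k {[1, 2, 3], [1, 3, 2]} = 2 * ((n - 1) choose (2 * k))"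
proof -
  \<comment> \<open>Two elements give two choices for the first entry; for \<open>n \<le> 1\<close>
    there is a single permutation, while the formula at \<open>k = 0\<close> would give 2.\<close>
  obtain m where n: "n = Suc (Suc m)"
    using assms by (metis Suc_le_D numeral_2_eq_2 Suc_le_mono)
  obtain u v A where A: "{1..n} = insert u (insert v A)" "u \<notin> A" "v \<notin> A" "v < u" "\<forall>x\<in>A. x < v"
      "finite A" "card A = m"
    using split_off_two_largest[of "{1..n}" m] n by auto
  let ?P = "\<lambda>B. {ys \<in> one_larger_perms B. ascents ys = k}"
  have "{\<pi> \<in> permutations_of_set {1..n}. (\<forall>\<rho>\<in>{[1, 2, 3], [1, 3, 2]}. avoids_pattern \<pi> \<rho>) \<and> vl \<pi> = k} =
      {\<pi> \<in> one_larger_perms {1..n}. vl \<pi> = k}"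
    using avoids_123_132_iff by (auto simp: one_larger_perms_def permutations_of_set_def)
  also have "\<dots> = {\<pi> \<in> one_larger_perms {1..n}. ascents (tl \<pi>) = k}"
  proof -
    have "vl \<pi> = ascents (tl \<pi>)" if "\<pi> \<in> one_larger_perms {1..n}" for \<pi>
      using that n vl_Cons_eq_ascents
      by (cases \<pi>) (auto simp: one_larger_perms_def permutations_of_set_def)
    then show ?thesis
      by auto
  qed
  \<comment> \<open>The condition now concerns the tail alone, which ranges over the arrangements of
    one of two sets of size \<open>n - 1\<close>; their counts agree, hence the factor 2.\<close>
  also have "\<dots> = (#) u ` ?P (insert v A) \<union> (#) v ` ?P (insert u A)"
    unfolding A(1) one_larger_perms_insert2[OF A(2-5)] by auto
  also have "card \<dots> = card (?P (insert v A)) + card (?P (insert u A))"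
    using A by (subst card_Un_disjoint) (auto simp: card_image)
  also have "\<dots> = 2 * ((n - 1) choose (2 * k))"
    using A n by (simp add: card_one_larger_perms_ascents(1))
  finally show ?thesis
    unfolding a_vl_def .
qed

end
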